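(* The following problem is undecidable: given a document theory $\mathcal{T}$ and constant lists $model$, $queue$, decide whether there exists a terminating chase sequence for $\langle model, queue\rangle$ with respect to $\mathcal{T}$.
   Context: Setting: the language of Semantic Modeling, a two-sorted first-order language (sorts "urelement" and "list") interpreted in hereditarily finite list superstructures $HW(\mathcal{M})$; lists are built from urelement constants and the empty list $\langle\ \rangle$ using ${\tt cons}$ (append a new last element), ${\tt conc}$ (concatenation), ${\tt head}$ (last element, $\langle\ \rangle$ for the empty list) and ${\tt tail}$ (list without its last element); quantifiers are bounded ($\forall x\in t$, $\exists x \sqsubseteq t$, etc., where $\sqsubseteq$ is "initial segment"); the language is extended by conditional terms ${\tt Cond}[\theta_1,q_1]\dots[\theta_n,q_n][q_{n+1}]$ (if–then–else), search terms ${\tt bSearch}$ (last element of a list satisfying a formula) and bounded-recursion terms ${\tt Rec}[f,h,t]$ (recursion along the initial segments of a list $t$). A natural number $n$ is the list of $n$ empty lists. "Document terms" are list terms built additionally from $+$, $\min$, $\max$, indexed access, and the accessors $GetLastDocID(model)$ (greatest document ID in a model), $GetDocByID(id,model)$ (last version of the document with that ID, or the constant ${\tt fault}$), $GetFieldValue(id,fieldName,model)$. A document theory $\mathcal{T}$ is given over pairwise disjoint finite sets of urelement constants $FieldNames$, $FormNames$ (non-empty), $FilterNames$, $TransNames$, together with distinguished constants $CreateDoc$, $SetField$, ${\tt fault}$. A field is a list whose head is a field name and whose tail is its value; a document is a list of fields. $\mathcal{T}$ contains: (i) for each field name a cardinality restriction on its value (empty / at most one element / exactly one / at least one); (ii)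 for each form name $f$ a blank document $Blank(f)$ consisting of a fixed set of fields with default values (and $Blank(x)={\tt fault}$ for $x\notin FormNames$); (iii) for each filter name a term $GetDocsByFilter_{name}(fName,model,params)$ returning the list of IDs of (the last versions of) documents of form $fName$ in $model$ satisfying a Boolean combination of comparisons $s<t$, $s=t$ between document terms; (iv) the update rules and daemons below. Instructions are lists $\langle formName, CreateDoc\rangle$ (CreateDoc-instruction), $\langle value, fieldName, docID, SetField\rangle$ (SetField-instruction) and $\langle params, docID, transName\rangle$ (transaction), with $docID$ a natural number. A queue is a list of instructions; a model is a list of tuples $\langle sit, form, doc, ID\rangle$ (versions of documents, $sit$ being the history of executed instructions). The function $Update(initialmodel, model, queue)$ processes the first instruction of the queue: if the queue is empty it returns $model$; if the first instruction is not of one of the three kinds it returns $initialmodel$; a CreateDoc-instruction appends a blank document of the given form with ID $=GetLastDocID(model)+1$ and removes the instruction (returning $initialmodel$ if the form name is invalid); a SetField-instruction, if the document $docID$ has the field and the new value satisfies its cardinality, appends a new version of the document with the updated field value and replaces the rest of the queue by $SetFieldTrigger(docID, fieldName, value, {\tt tail}(queue), model)$ (otherwise returns $initialmodel$); a transaction leaves the model unchanged and replaces the rest of the queue by $ExecTrans(transName, docID, params, {\tt tail}(queue), model)$; then $Update$ recurses. The daemons $SetFieldTrigger$ and $ExecTrans$ are defined as ${\tt Cond}[\theta_1,q_1]\dots[\theta_n,q_n][queue]$. In $SetFieldTrigger$ each $\theta_i$ is a $(formName, fieldName)$-condition: "the form of document $docID$ is $formName$, the changed field is $fieldName$, and $\varphi$",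 $\varphi$ a Boolean combination of $<,=$ comparisons of document terms; in $ExecTrans$ each $\theta_i$ is a $(formName, transName)$-condition: "the form of document $docID$ is $formName$, the transaction name is $transName$, and $\varphi$". Each $q_i={\tt conc}(queue, instr_i)$ where the queue extension $instr_i$ is a concatenation of instruction terms, each of which is either a single SetField-instruction on field $fieldName'$ of the same document (a $(formName, fieldName')$-instruction), or a ${\tt Rec}$-term that, for every ID in a filter result $GetDocsByFilter_{name}(frmName, model, p)$, emits a transaction $\langle params, id, transName\rangle$ (a $(frmName, transName)$-instruction); in $ExecTrans$ additionally an instruction term may emit $\langle frmName, CreateDoc\rangle$ once, or once per ID of a filter result (a $(frmName, CreateDoc)$-instruction). Values and parameters are document terms over the daemon's arguments. Chase: for constant lists $model$ and non-empty $queue$, $\langle model, queue\rangle \mapsto \langle model', queue'\rangle$ denotes one non-recursive unfolding step of $Update$ (processing ${\tt head}(queue)$), so that $Update(model, model, queue)=Update(model, model', queue')$. A chase sequence for $\langle m_0,q_0\rangle$ is a sequence $\langle m_0,q_0\rangle,\langle m_1,q_1\rangle,\dots$ with $\langle m_i,q_i\rangle\mapsto\langle m_{i+1},q_{i+1}\rangle$; it is terminating if it is finite, $s_0,\dots,s_k$ with $k\ge 1$, and $s_k=\langle m_k,\langle\ \rangle\rangle$. *)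

theory Defs
  imports "HOL-Library.Nat_Bijection" "HOL-Library.Sublist"
begin

section \<open>Partial recursive functions and decidable problems\<close>

datatype recf =
    Zero
  | Succ
  | Proj nat
  | Comp recf "recf list"
  | PrimRec recf recf
  | Mu recf

text \<open>
  \<open>reval f xs y\<close>: the partial recursive function denoted by \<open>f\<close> is defined on \<open>xs\<close> with
  value \<open>y\<close>.  The recursion variable of \<open>PrimRec\<close> and the minimised variable of \<open>Mu\<close> come
  first in the argument list, and projections count from 0.
\<close>

inductive reval :: "recf \<Rightarrow> nat list \<Rightarrow> nat \<Rightarrow> bool" where
  "reval Zero xs 0"
| "reval Succ [x] (Suc x)"
| "i < length xs \<Longrightarrow> reval (Proj i) xs (xs ! i)"
| "list_all2 (\<lambda>g y. reval g xs y) gs ys \<Longrightarrow> reval f ys z \<Longrightarrow> reval (Comp f gs) xs z"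
| "reval f xs z \<Longrightarrow> reval (PrimRec f g) (0 # xs) z"
| "reval (PrimRec f g) (n # xs) y \<Longrightarrow> reval g (n # y # xs) z
     \<Longrightarrow> reval (PrimRec f g) (Suc n # xs) z"
| "reval f (n # xs) 0 \<Longrightarrow> (\<forall>i<n. \<exists>y. reval f (i # xs) (Suc y)) \<Longrightarrow> reval (Mu f) xs n"

text \<open>
  The problem with instance set \<open>I\<close>, Goedel numbering \<open>code\<close> and question \<open>P\<close>.  Nothing is
  required of the algorithm on numbers that do not code an instance.
\<close>

definition decidable_problem :: "('i \<Rightarrow> nat) \<Rightarrow> 'i set \<Rightarrow> ('i \<Rightarrow> bool) \<Rightarrow> bool" where
  "decidable_problem code I P \<longleftrightarrow>
     (\<exists>f. \<forall>x\<in>I. reval f [code x] (if P x then 1 else 0))"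


section \<open>Hereditarily finite lists\<close>

datatype urelement = CreateDoc | SetField | Fault | Name nat

datatype obj = Ur urelement | Ls "obj list"

text \<open>
  Lists are written left to right, so the head is the rightmost element.  The list operations
  are totalised by reading an urelement in a list position as the empty list.
\<close>

primrec elems :: "obj \<Rightarrow> obj list" where
  "elems (Ur u) = []"
| "elems (Ls xs) = xs"

definition head :: "obj \<Rightarrow> obj" where
  "head x = (if elems x = [] then Ls [] else last (elems x))"

definition tail :: "obj \<Rightarrow> obj" where
  "tail x = Ls (butlast (elems x))"

definition cons :: "obj \<Rightarrow> obj \<Rightarrow> obj" where
  "cons x y = Ls (elems x @ [y])"

definition conc :: "obj \<Rightarrow> obj \<Rightarrow> obj" where
  "conc x y = Ls (elems x @ elems y)"

fun initial_segment :: "obj \<Rightarrow> obj \<Rightarrow> bool" where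
  "initial_segment (Ls xs) (Ls ys) = prefix xs ys"
| "initial_segment _ _ = False"

primrec cond :: "(bool \<times> 'a) list \<Rightarrow> 'a \<Rightarrow> 'a" where
  "cond [] q = q"
| "cond (c # cs) q = (if fst c then snd c else cond cs q)"

definition bsearch :: "(obj \<Rightarrow> bool) \<Rightarrow> obj \<Rightarrow> obj" where
  "bsearch P t = head (Ls (filter P (elems t)))"

text \<open>Here \<open>h\<close> takes the value on an initial segment and the element that follows it.\<close>

definition rec_term :: "'a \<Rightarrow> ('a \<Rightarrow> obj \<Rightarrow> 'a) \<Rightarrow> obj \<Rightarrow> 'a" where
  "rec_term f h t = foldl h f (elems t)"

definition numeral_obj :: "nat \<Rightarrow> obj" where
  "numeral_obj n = Ls (replicate n (Ls []))"

definition is_natural :: "obj \<Rightarrow> bool" where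
  "is_natural x \<longleftrightarrow> (\<exists>n. x = numeral_obj n)"

text \<open>
  On natural numbers (lists of empty lists) the following are the usual order, minimum and
  maximum, and \<open>conc\<close> is addition.
\<close>

definition obj_less :: "obj \<Rightarrow> obj \<Rightarrow> bool" where
  "obj_less x y \<longleftrightarrow> initial_segment x y \<and> x \<noteq> y"

definition obj_min :: "obj \<Rightarrow> obj \<Rightarrow> obj" where
  "obj_min x y = cond [(initial_segment x y, x)] y"

definition obj_max :: "obj \<Rightarrow> obj \<Rightarrow> obj" where
  "obj_max x y = cond [(initial_segment x y, y)] x"

text \<open>Positions count from 1; the result is the empty list if there is no such element.\<close>

definition index :: "obj \<Rightarrow> obj \<Rightarrow> obj" where
  "index x i =
     (let k = length (elems i) in
      if is_natural i \<and> 1 \<le> k \<and> k \<le> length (elems x) then elems x ! (k - 1) else Ls [])"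


section \<open>Models and documents\<close>

text \<open>A version of a document is a list \<open>\<langle>sit, form, doc, ID\<rangle>\<close>.\<close>

definition version_id :: "obj \<Rightarrow> obj" where
  "version_id v = head v"

definition version_doc :: "obj \<Rightarrow> obj" where
  "version_doc v = head (tail v)"

definition version_form :: "obj \<Rightarrow> obj" where
  "version_form v = head (tail (tail v))"

definition version_sit :: "obj \<Rightarrow> obj" where
  "version_sit v = head (tail (tail (tail v)))"

definition get_last_doc_id :: "obj \<Rightarrow> obj" where
  "get_last_doc_id model = rec_term (numeral_obj 0) (\<lambda>m v. obj_max m (version_id v)) model"

definition get_doc_by_id :: "obj \<Rightarrow> obj \<Rightarrow> obj" where
  "get_doc_by_id i model =
     cond [(\<exists>v\<in>set (elems model). version_id v = i, bsearch (\<lambda>v. version_id v = i) model)]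
       (Ur Fault)"

text \<open>A field is \<open>cons value fieldName\<close>: its head is the field name, its tail the value.\<close>

definition has_field :: "obj \<Rightarrow> obj \<Rightarrow> bool" where
  "has_field doc f \<longleftrightarrow> (\<exists>x\<in>set (elems doc). head x = f)"

definition get_field_value :: "obj \<Rightarrow> obj \<Rightarrow> obj \<Rightarrow> obj" where
  "get_field_value i f model =
     (let doc = version_doc (get_doc_by_id i model) in
      cond [(has_field doc f, tail (bsearch (\<lambda>x. head x = f) doc))] (Ur Fault))"

definition update_field :: "obj \<Rightarrow> obj \<Rightarrow> obj \<Rightarrow> obj" where
  "update_field f value doc = Ls (map (\<lambda>x. if head x = f then cons value f else x) (elems doc))"

fun last_versions :: "obj list \<Rightarrow> obj list" where
  "last_versions [] = []"
| "last_versions (v # vs) =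
     (if \<exists>w\<in>set vs. version_id w = version_id v then last_versions vs else v # last_versions vs)"

text \<open>The history of executed instructions is recorded in the most recent version.\<close>

definition current_sit :: "obj \<Rightarrow> obj" where
  "current_sit model = version_sit (head model)"


section \<open>Syntax of document theories\<close>

datatype 'v dterm =
    TVar 'v
  | TConst urelement
  | TNil
  | TCons "'v dterm" "'v dterm"
  | TConc "'v dterm" "'v dterm"
  | THead "'v dterm"
  | TTail "'v dterm"
  | TPlus "'v dterm" "'v dterm"
  | TMin "'v dterm" "'v dterm"
  | TMax "'v dterm" "'v dterm"
  | TIndex "'v dterm" "'v dterm"
  | TGetLastDocID "'v dterm"
  | TGetDocByID "'v dterm" "'v dterm"
  | TGetFieldValue "'v dterm" "'v dterm" "'v dterm"

datatype 'v bform =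
    FLess "'v dterm" "'v dterm"
  | FEq "'v dterm" "'v dterm"
  | FNot "'v bform"
  | FAnd "'v bform" "'v bform"
  | FOr "'v bform" "'v bform"

text \<open>
  The variables of filters, of \<open>SetFieldTrigger\<close> and of \<open>ExecTrans\<close>; \<open>FilterID\<close> stands for
  the ID of the document under test.
\<close>

datatype filter_var = FilterID | FilterForm | FilterModel | FilterParams

datatype trigger_var = TrigDocID | TrigFieldName | TrigValue | TrigQueue | TrigModel

datatype trans_var = TransName | TransDocID | TransParams | TransQueue | TransModel

text \<open>
  Instruction terms; numbers are the indices of name constants.
  \<^item> \<open>SetOne fieldName t\<close>: the instruction \<open>\<langle>t, fieldName, docID, SetField\<rangle>\<close>.
  \<^item> \<open>CallEach filter frmName p params transName\<close>: the instruction
    \<open>\<langle>params, id, transName\<rangle>\<close> for every \<open>id\<close> in the result of the filter applied to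
    \<open>frmName\<close>, \<open>model\<close>, \<open>p\<close>.
  \<^item> \<open>CreateOne frmName\<close>: the instruction \<open>\<langle>frmName, CreateDoc\<rangle>\<close>.
  \<^item> \<open>CreateEach filter form p frmName\<close>: the instruction \<open>\<langle>frmName, CreateDoc\<rangle>\<close> for every ID
    in the result of the filter applied to \<open>form\<close>, \<open>model\<close>, \<open>p\<close>.
\<close>

datatype 'v instr =
    SetOne nat "'v dterm"
  | CallEach nat nat "'v dterm" "'v dterm" nat
  | CreateOne nat
  | CreateEach nat nat "'v dterm" nat

text \<open>
  A branch of a daemon: \<open>rule_key\<close> is the field name for \<open>SetFieldTrigger\<close> and the transaction
  name for \<open>ExecTrans\<close>.
\<close>

datatype 'v rule =
  Rule (rule_form: nat) (rule_key: nat) (rule_cond: "'v bform") (rule_instrs: "'v instr list")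

datatype cardinality = Empty | AtMostOne | ExactlyOne | AtLeastOne

datatype doc_theory = DocTheory
  (fields: "(nat \<times> cardinality) list")
  (forms: "(nat \<times> (nat \<times> obj list) list) list")
  (filters: "(nat \<times> filter_var bform) list")
  (trans_names: "nat list")
  (trigger_rules: "trigger_var rule list")
  (trans_rules: "trans_var rule list")

definition field_names :: "doc_theory \<Rightarrow> nat set" where
  "field_names T = set (map fst (fields T))"

definition form_names :: "doc_theory \<Rightarrow> nat set" where
  "form_names T = set (map fst (forms T))"

definition filter_names :: "doc_theory \<Rightarrow> nat set" where
  "filter_names T = set (map fst (filters T))"

primrec instr_over :: "doc_theory \<Rightarrow> 'v instr \<Rightarrow> bool" where
  "instr_over T (SetOne fld t) \<longleftrightarrow> fld \<in> field_names T"
| "instr_over T (CallEach flt frm p params tr) \<longleftrightarrow>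
     flt \<in> filter_names T \<and> frm \<in> form_names T \<and> tr \<in> set (trans_names T)"
| "instr_over T (CreateOne frm) \<longleftrightarrow> frm \<in> form_names T"
| "instr_over T (CreateEach flt frm p new) \<longleftrightarrow>
     flt \<in> filter_names T \<and> frm \<in> form_names T \<and> new \<in> form_names T"

primrec creates_document :: "'v instr \<Rightarrow> bool" where
  "creates_document (SetOne fld t) = False"
| "creates_document (CallEach flt frm p params tr) = False"
| "creates_document (CreateOne frm) = True"
| "creates_document (CreateEach flt frm p new) = True"

text \<open>
  The \<open>distinct\<close> condition says that no name is declared twice and that the four sets of names
  are pairwise disjoint.
\<close>

definition document_theory :: "doc_theory \<Rightarrow> bool" where
  "document_theory T \<longleftrightarrow>
     distinct (map fst (fields T) @ map fst (forms T) @ map fst (filters T) @ trans_names T) \<and>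
     forms T \<noteq> [] \<and>
     (\<forall>(f, blank)\<in>set (forms T).
        distinct (map fst blank) \<and> set (map fst blank) \<subseteq> field_names T) \<and>
     (\<forall>r\<in>set (trigger_rules T).
        rule_form r \<in> form_names T \<and> rule_key r \<in> field_names T \<and>
        (\<forall>i\<in>set (rule_instrs r). instr_over T i \<and> \<not> creates_document i)) \<and>
     (\<forall>r\<in>set (trans_rules T).
        rule_form r \<in> form_names T \<and> rule_key r \<in> set (trans_names T) \<and>
        (\<forall>i\<in>set (rule_instrs r). instr_over T i))"


section \<open>Semantics of document theories\<close>

primrec eval_dterm :: "('v \<Rightarrow> obj) \<Rightarrow> 'v dterm \<Rightarrow> obj" where
  "eval_dterm e (TVar v) = e v"
| "eval_dterm e (TConst u) = Ur u"
| "eval_dterm e TNil = Ls []"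
| "eval_dterm e (TCons s t) = cons (eval_dterm e s) (eval_dterm e t)"
| "eval_dterm e (TConc s t) = conc (eval_dterm e s) (eval_dterm e t)"
| "eval_dterm e (THead t) = head (eval_dterm e t)"
| "eval_dterm e (TTail t) = tail (eval_dterm e t)"
| "eval_dterm e (TPlus s t) = conc (eval_dterm e s) (eval_dterm e t)"
| "eval_dterm e (TMin s t) = obj_min (eval_dterm e s) (eval_dterm e t)"
| "eval_dterm e (TMax s t) = obj_max (eval_dterm e s) (eval_dterm e t)"
| "eval_dterm e (TIndex t i) = index (eval_dterm e t) (eval_dterm e i)"
| "eval_dterm e (TGetLastDocID m) = get_last_doc_id (eval_dterm e m)"
| "eval_dterm e (TGetDocByID i m) = get_doc_by_id (eval_dterm e i) (eval_dterm e m)"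
| "eval_dterm e (TGetFieldValue i f m) =
     get_field_value (eval_dterm e i) (eval_dterm e f) (eval_dterm e m)"

primrec eval_bform :: "('v \<Rightarrow> obj) \<Rightarrow> 'v bform \<Rightarrow> bool" where
  "eval_bform e (FLess s t) \<longleftrightarrow> obj_less (eval_dterm e s) (eval_dterm e t)"
| "eval_bform e (FEq s t) \<longleftrightarrow> eval_dterm e s = eval_dterm e t"
| "eval_bform e (FNot p) \<longleftrightarrow> \<not> eval_bform e p"
| "eval_bform e (FAnd p q) \<longleftrightarrow> eval_bform e p \<and> eval_bform e q"
| "eval_bform e (FOr p q) \<longleftrightarrow> eval_bform e p \<or> eval_bform e q"

primrec filter_env :: "obj \<Rightarrow> obj \<Rightarrow> obj \<Rightarrow> obj \<Rightarrow> filter_var \<Rightarrow> obj" where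
  "filter_env i form model params FilterID = i"
| "filter_env i form model params FilterForm = form"
| "filter_env i form model params FilterModel = model"
| "filter_env i form model params FilterParams = params"

primrec trigger_env :: "obj \<Rightarrow> obj \<Rightarrow> obj \<Rightarrow> obj \<Rightarrow> obj \<Rightarrow> trigger_var \<Rightarrow> obj" where
  "trigger_env docid fld value queue model TrigDocID = docid"
| "trigger_env docid fld value queue model TrigFieldName = fld"
| "trigger_env docid fld value queue model TrigValue = value"
| "trigger_env docid fld value queue model TrigQueue = queue"
| "trigger_env docid fld value queue model TrigModel = model"

primrec trans_env :: "obj \<Rightarrow> obj \<Rightarrow> obj \<Rightarrow> obj \<Rightarrow> obj \<Rightarrow> trans_var \<Rightarrow> obj" where
  "trans_env tr docid params queue model TransName = tr"
| "trans_env tr docid params queue model TransDocID = docid"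
| "trans_env tr docid params queue model TransParams = params"
| "trans_env tr docid params queue model TransQueue = queue"
| "trans_env tr docid params queue model TransModel = model"

definition get_docs_by_filter :: "doc_theory \<Rightarrow> nat \<Rightarrow> obj \<Rightarrow> obj \<Rightarrow> obj \<Rightarrow> obj" where
  "get_docs_by_filter T flt form model params =
     (case map_of (filters T) flt of
        None \<Rightarrow> Ls []
      | Some \<phi> \<Rightarrow> Ls (map version_id (filter
          (\<lambda>v. version_form v = form \<and> eval_bform (filter_env (version_id v) form model params) \<phi>)
          (last_versions (elems model)))))"

text \<open>The arguments \<open>docid\<close> and \<open>model\<close> are those of the daemon whose environment is \<open>e\<close>.\<close>

primrec eval_instr :: "doc_theory \<Rightarrow> ('v \<Rightarrow> obj) \<Rightarrow> obj \<Rightarrow> obj \<Rightarrow> 'v instr \<Rightarrow> obj" where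
  "eval_instr T e docid model (SetOne fld t) =
     Ls [Ls [eval_dterm e t, Ur (Name fld), docid, Ur SetField]]"
| "eval_instr T e docid model (CallEach flt frm p params tr) =
     rec_term (Ls []) (\<lambda>acc i. cons acc (Ls [eval_dterm e params, i, Ur (Name tr)]))
       (get_docs_by_filter T flt (Ur (Name frm)) model (eval_dterm e p))"
| "eval_instr T e docid model (CreateOne frm) = Ls [Ls [Ur (Name frm), Ur CreateDoc]]"
| "eval_instr T e docid model (CreateEach flt frm p new) =
     rec_term (Ls []) (\<lambda>acc i. cons acc (Ls [Ur (Name new), Ur CreateDoc]))
       (get_docs_by_filter T flt (Ur (Name frm)) model (eval_dterm e p))"

definition eval_instrs :: "doc_theory \<Rightarrow> ('v \<Rightarrow> obj) \<Rightarrow> obj \<Rightarrow> obj \<Rightarrow> 'v instr list \<Rightarrow> obj" where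
  "eval_instrs T e docid model is = foldl conc (Ls []) (map (eval_instr T e docid model) is)"

text \<open>
  The common shape \<open>Cond[\<theta>\<^sub>1,q\<^sub>1]\<dots>[\<theta>\<^sub>n,q\<^sub>n][queue]\<close> of the two daemons, where \<open>key\<close> is the changed
  field, respectively the name of the transaction.
\<close>

definition run_rules ::
  "doc_theory \<Rightarrow> 'v rule list \<Rightarrow> ('v \<Rightarrow> obj) \<Rightarrow> obj \<Rightarrow> obj \<Rightarrow> obj \<Rightarrow> obj \<Rightarrow> obj" where
  "run_rules T rs e docid key queue model =
     cond (map (\<lambda>r. (version_form (get_doc_by_id docid model) = Ur (Name (rule_form r)) \<and>
                      key = Ur (Name (rule_key r)) \<and> eval_bform e (rule_cond r),
                    conc queue (eval_instrs T e docid model (rule_instrs r)))) rs)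
       queue"

definition set_field_trigger ::
  "doc_theory \<Rightarrow> obj \<Rightarrow> obj \<Rightarrow> obj \<Rightarrow> obj \<Rightarrow> obj \<Rightarrow> obj" where
  "set_field_trigger T docid fld value queue model =
     run_rules T (trigger_rules T) (trigger_env docid fld value queue model) docid fld queue model"

definition exec_trans ::
  "doc_theory \<Rightarrow> obj \<Rightarrow> obj \<Rightarrow> obj \<Rightarrow> obj \<Rightarrow> obj \<Rightarrow> obj" where
  "exec_trans T tr docid params queue model =
     run_rules T (trans_rules T) (trans_env tr docid params queue model) docid tr queue model"

definition blank :: "doc_theory \<Rightarrow> obj \<Rightarrow> obj" where
  "blank T x =
     (case x of
        Ur (Name f) \<Rightarrow>
          (case map_of (forms T) f of
             None \<Rightarrow> Ur Fault
           | Some fs \<Rightarrow> Ls (map (\<lambda>(fld, value). cons (Ls value) (Ur (Name fld))) fs))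
      | _ \<Rightarrow> Ur Fault)"

primrec satisfies_cardinality :: "obj list \<Rightarrow> cardinality \<Rightarrow> bool" where
  "satisfies_cardinality xs Empty \<longleftrightarrow> length xs = 0"
| "satisfies_cardinality xs AtMostOne \<longleftrightarrow> length xs \<le> 1"
| "satisfies_cardinality xs ExactlyOne \<longleftrightarrow> length xs = 1"
| "satisfies_cardinality xs AtLeastOne \<longleftrightarrow> length xs \<ge> 1"

definition admissible_value :: "doc_theory \<Rightarrow> nat \<Rightarrow> obj \<Rightarrow> bool" where
  "admissible_value T fld value \<longleftrightarrow>
     (\<exists>xs c. value = Ls xs \<and> map_of (fields T) fld = Some c \<and> satisfies_cardinality xs c)"


section \<open>The chase\<close>

text \<open>
  A single unfolding of \<open>Update(initialmodel, model, queue)\<close>: either the final value of \<open>Update\<close>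
  (\<open>Return\<close>), or the model and the queue of the recursive call.
\<close>

datatype update_result = Return "obj list" | Recurse "obj list" "obj list"

definition update_unfold ::
  "doc_theory \<Rightarrow> obj list \<Rightarrow> obj list \<Rightarrow> obj list \<Rightarrow> update_result" where
  "update_unfold T initialmodel model queue =
     (if queue = [] then Return model
      else
        let instr = last queue;
            rest = butlast queue;
            sit = cons (current_sit (Ls model)) instr
        in case instr of
          Ls [form, Ur CreateDoc] \<Rightarrow>
            if blank T form = Ur Fault then Return initialmodel
            else Recurse
              (model @ [Ls [sit, form, blank T form,
                            conc (get_last_doc_id (Ls model)) (numeral_obj 1)]])
              rest
        | Ls [value, Ur (Name fld), docid, Ur SetField] \<Rightarrow>
            let v = get_doc_by_id docid (Ls model) in
            if is_natural docid \<and> has_field (version_doc v) (Ur (Name fld)) \<and>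
               admissible_value T fld value
            then Recurse
              (model @ [Ls [sit, version_form v,
                            update_field (Ur (Name fld)) value (version_doc v), docid]])
              (elems (set_field_trigger T docid (Ur (Name fld)) value (Ls rest) (Ls model)))
            else Return initialmodel
        | Ls [params, docid, Ur (Name tr)] \<Rightarrow>
            if is_natural docid \<and> tr \<in> set (trans_names T)
            then Recurse model (elems (exec_trans T (Ur (Name tr)) docid params (Ls rest) (Ls model)))
            else Return initialmodel
        | _ \<Rightarrow> Return initialmodel)"

definition chase_step ::
  "doc_theory \<Rightarrow> obj list \<times> obj list \<Rightarrow> obj list \<times> obj list \<Rightarrow> bool" where
  "chase_step T s s' \<longleftrightarrow>
     snd s \<noteq> [] \<and> update_unfold T (fst s) (fst s) (snd s) = Recurse (fst s') (snd s')"

definition terminating_chase_sequence ::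
  "doc_theory \<Rightarrow> obj list \<times> obj list \<Rightarrow> (obj list \<times> obj list) list \<Rightarrow> bool" where
  "terminating_chase_sequence T s ss \<longleftrightarrow>
     (\<exists>k\<ge>1. length ss = k + 1 \<and> ss ! 0 = s \<and>
        (\<forall>i<k. chase_step T (ss ! i) (ss ! (i + 1))) \<and> snd (ss ! k) = [])"


section \<open>Goedel numbering of the instances\<close>

primrec code_urelement :: "urelement \<Rightarrow> nat" where
  "code_urelement CreateDoc = 0"
| "code_urelement SetField = 1"
| "code_urelement Fault = 2"
| "code_urelement (Name n) = n + 3"

primrec code_obj :: "obj \<Rightarrow> nat" where
  "code_obj (Ur u) = list_encode [0, code_urelement u]"
| "code_obj (Ls xs) = list_encode [1, list_encode (map code_obj xs)]"

definition code_objs :: "obj list \<Rightarrow> nat" where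
  "code_objs xs = list_encode (map code_obj xs)"

primrec code_filter_var :: "filter_var \<Rightarrow> nat" where
  "code_filter_var FilterID = 0"
| "code_filter_var FilterForm = 1"
| "code_filter_var FilterModel = 2"
| "code_filter_var FilterParams = 3"

primrec code_trigger_var :: "trigger_var \<Rightarrow> nat" where
  "code_trigger_var TrigDocID = 0"
| "code_trigger_var TrigFieldName = 1"
| "code_trigger_var TrigValue = 2"
| "code_trigger_var TrigQueue = 3"
| "code_trigger_var TrigModel = 4"

primrec code_trans_var :: "trans_var \<Rightarrow> nat" where
  "code_trans_var TransName = 0"
| "code_trans_var TransDocID = 1"
| "code_trans_var TransParams = 2"
| "code_trans_var TransQueue = 3"
| "code_trans_var TransModel = 4"

primrec code_dterm :: "('v \<Rightarrow> nat) \<Rightarrow> 'v dterm \<Rightarrow> nat" where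
  "code_dterm c (TVar v) = list_encode [0, c v]"
| "code_dterm c (TConst u) = list_encode [1, code_urelement u]"
| "code_dterm c TNil = list_encode [2]"
| "code_dterm c (TCons s t) = list_encode [3, code_dterm c s, code_dterm c t]"
| "code_dterm c (TConc s t) = list_encode [4, code_dterm c s, code_dterm c t]"
| "code_dterm c (THead t) = list_encode [5, code_dterm c t]"
| "code_dterm c (TTail t) = list_encode [6, code_dterm c t]"
| "code_dterm c (TPlus s t) = list_encode [7, code_dterm c s, code_dterm c t]"
| "code_dterm c (TMin s t) = list_encode [8, code_dterm c s, code_dterm c t]"
| "code_dterm c (TMax s t) = list_encode [9, code_dterm c s, code_dterm c t]"
| "code_dterm c (TIndex t i) = list_encode [10, code_dterm c t, code_dterm c i]"
| "code_dterm c (TGetLastDocID m) = list_encode [11, code_dterm c m]"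
| "code_dterm c (TGetDocByID i m) = list_encode [12, code_dterm c i, code_dterm c m]"
| "code_dterm c (TGetFieldValue i f m) =
     list_encode [13, code_dterm c i, code_dterm c f, code_dterm c m]"

primrec code_bform :: "('v \<Rightarrow> nat) \<Rightarrow> 'v bform \<Rightarrow> nat" where
  "code_bform c (FLess s t) = list_encode [0, code_dterm c s, code_dterm c t]"
| "code_bform c (FEq s t) = list_encode [1, code_dterm c s, code_dterm c t]"
| "code_bform c (FNot p) = list_encode [2, code_bform c p]"
| "code_bform c (FAnd p q) = list_encode [3, code_bform c p, code_bform c q]"
| "code_bform c (FOr p q) = list_encode [4, code_bform c p, code_bform c q]"

primrec code_instr :: "('v \<Rightarrow> nat) \<Rightarrow> 'v instr \<Rightarrow> nat" where
  "code_instr c (SetOne fld t) = list_encode [0, fld, code_dterm c t]"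
| "code_instr c (CallEach flt frm p params tr) =
     list_encode [1, flt, frm, code_dterm c p, code_dterm c params, tr]"
| "code_instr c (CreateOne frm) = list_encode [2, frm]"
| "code_instr c (CreateEach flt frm p new) = list_encode [3, flt, frm, code_dterm c p, new]"

primrec code_rule :: "('v \<Rightarrow> nat) \<Rightarrow> 'v rule \<Rightarrow> nat" where
  "code_rule c (Rule frm key \<phi> is) =
     list_encode [frm, key, code_bform c \<phi>, list_encode (map (code_instr c) is)]"

primrec code_cardinality :: "cardinality \<Rightarrow> nat" where
  "code_cardinality Empty = 0"
| "code_cardinality AtMostOne = 1"
| "code_cardinality ExactlyOne = 2"
| "code_cardinality AtLeastOne = 3"

definition code_form :: "nat \<times> (nat \<times> obj list) list \<Rightarrow> nat" where
  "code_form x = list_encode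
     [fst x, list_encode (map (\<lambda>y. list_encode [fst y, code_objs (snd y)]) (snd x))]"

primrec code_theory :: "doc_theory \<Rightarrow> nat" where
  "code_theory (DocTheory flds frms flts trs rs1 rs2) = list_encode
     [list_encode (map (\<lambda>x. list_encode [fst x, code_cardinality (snd x)]) flds),
      list_encode (map code_form frms),
      list_encode (map (\<lambda>x. list_encode [fst x, code_bform code_filter_var (snd x)]) flts),
      list_encode trs,
      list_encode (map (code_rule code_trigger_var) rs1),
      list_encode (map (code_rule code_trans_var) rs2)]"

definition code_instance :: "doc_theory \<times> obj list \<times> obj list \<Rightarrow> nat" where
  "code_instance x =
     list_encode [code_theory (fst x), code_objs (fst (snd x)), code_objs (snd (snd x))]"

lemma inj_code_urelement: "inj code_urelement"
proof (rule injI)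
  fix x y assume "code_urelement x = code_urelement y"
  then show "x = y" by (cases x; cases y) auto
qed

lemma code_obj_eq: "code_obj x = code_obj y \<Longrightarrow> x = y"
proof (induction x arbitrary: y)
  case (Ur u)
  then show ?case by (cases y) (auto simp: list_encode_eq inj_eq[OF inj_code_urelement])
next
  case (Ls xs)
  from Ls.prems obtain ys where y: "y = Ls ys" and eq: "map code_obj xs = map code_obj ys"
    by (cases y) (auto simp: list_encode_eq)
  from eq Ls.IH have "xs = ys"
    by (intro nth_equalityI) (metis length_map, metis length_map nth_map nth_mem)
  then show ?case using y by simp
qed

lemma inj_code_obj: "inj code_obj"
  by (rule injI) (rule code_obj_eq)

lemma inj_map_encode: "inj f \<Longrightarrow> inj (\<lambda>xs. list_encode (map f xs))"
  by (rule injI) (simp add: list_encode_eq inj_map_eq_map)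

lemma inj_code_objs: "inj code_objs"
  unfolding code_objs_def by (rule inj_map_encode[OF inj_code_obj])

lemma code_dterm_eq: "inj c \<Longrightarrow> code_dterm c s = code_dterm c t \<Longrightarrow> s = t"
  by (induction s arbitrary: t; case_tac t)
    (auto simp: list_encode_eq inj_eq[OF inj_code_urelement] dest: injD)

lemma inj_code_dterm: "inj c \<Longrightarrow> inj (code_dterm c)"
  by (rule injI) (rule code_dterm_eq)

lemma code_bform_eq: "inj c \<Longrightarrow> code_bform c p = code_bform c q \<Longrightarrow> p = q"
  by (induction p arbitrary: q; case_tac q) (auto simp: list_encode_eq dest: code_dterm_eq)

lemma inj_code_bform: "inj c \<Longrightarrow> inj (code_bform c)"
  by (rule injI) (rule code_bform_eq)

lemma inj_code_instr: "inj c \<Longrightarrow> inj (code_instr c)"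
proof (rule injI)
  fix x y assume "inj c" "code_instr c x = code_instr c y"
  then show "x = y" by (cases x; cases y) (auto simp: list_encode_eq dest: code_dterm_eq)
qed

lemma inj_code_rule: "inj c \<Longrightarrow> inj (code_rule c)"
proof (rule injI)
  fix x y assume "inj c" "code_rule c x = code_rule c y"
  then show "x = y"
    by (cases x; cases y)
      (auto simp: list_encode_eq inj_map_eq_map[OF inj_code_instr] dest: code_bform_eq)
qed

lemma inj_code_cardinality: "inj code_cardinality"
proof (rule injI)
  fix x y assume "code_cardinality x = code_cardinality y"
  then show "x = y" by (cases x; cases y) auto
qed

lemma inj_code_filter_var: "inj code_filter_var"
proof (rule injI)
  fix x y assume "code_filter_var x = code_filter_var y"
  then show "x = y" by (cases x; cases y) auto
qed

lemma inj_code_trigger_var: "inj code_trigger_var"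
proof (rule injI)
  fix x y assume "code_trigger_var x = code_trigger_var y"
  then show "x = y" by (cases x; cases y) auto
qed

lemma inj_code_trans_var: "inj code_trans_var"
proof (rule injI)
  fix x y assume "code_trans_var x = code_trans_var y"
  then show "x = y" by (cases x; cases y) auto
qed

lemma inj_encode_pair: "inj g \<Longrightarrow> inj (\<lambda>x. list_encode [fst x, g (snd x)])"
  by (rule injI) (auto simp: list_encode_eq prod_eq_iff dest: injD)

lemma inj_code_form: "inj code_form"
  using inj_encode_pair[OF inj_map_encode[OF inj_encode_pair[OF inj_code_objs]]]
  unfolding code_form_def .

lemma inj_code_theory: "inj code_theory"
proof (rule injI)
  fix x y assume "code_theory x = code_theory y"
  then show "x = y"
    by (cases x; cases y)
      (auto simp: list_encode_eq inj_map_eq_map[OF inj_encode_pair[OF inj_code_cardinality]]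
        inj_map_eq_map[OF inj_code_form]
        inj_map_eq_map[OF inj_encode_pair[OF inj_code_bform[OF inj_code_filter_var]]]
        inj_map_eq_map[OF inj_code_rule[OF inj_code_trigger_var]]
        inj_map_eq_map[OF inj_code_rule[OF inj_code_trans_var]]
        simp del: list_encode.simps)
qed

lemma inj_code_instance: "inj code_instance"
proof (rule injI)
  fix x y assume "code_instance x = code_instance y"
  then show "x = y"
    by (cases x; cases y)
      (auto simp: code_instance_def list_encode_eq inj_eq[OF inj_code_theory]
        inj_eq[OF inj_code_objs])
qed

end

theory Submission
  imports Defs
begin

text \<open>
  A single transaction whose parameter is a configuration of an abstract machine suffices: the
  machine interprets partial recursive functions given as data, so the theory and the model are
  fixed and the program sits in the queue.  It halts with an empty queue on result 0 and repeats
  itself forever on a nonzero result.  If \<open>f\<close> decided termination, then the function \<open>g\<close> that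
  maps \<open>n\<close> to the answer of \<open>f\<close> for the instance which runs the program with code \<open>n\<close> on \<open>n\<close>
  would, on its own code, terminate if and only if it does not.  The program is part of the
  instance, so \<open>g\<close> only has to compute the Goedel number of an instance from that of a program;
  since \<open>f\<close> is total on instances, only one direction of the simulation is needed.
\<close>

section \<open>Recursive functions for list codes\<close>

primrec const_rf :: "nat \<Rightarrow> recf" where
  "const_rf 0 = Zero"
| "const_rf (Suc n) = Comp Succ [const_rf n]"

definition add_rf :: recf where
  "add_rf = PrimRec (Proj 0) (Comp Succ [Proj 1])"

definition triangle_rf :: recf where
  "triangle_rf = PrimRec Zero (Comp add_rf [Proj 1, Comp Succ [Proj 0]])"

text \<open>\<open>list_encode\<close> codes a nonempty list as the successor of a Cantor pair, here
  \<open>triangle (x + l) + x\<close>.\<close>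

definition encode_cons_rf :: recf where
  "encode_cons_rf =
     Comp Succ [Comp add_rf [Comp triangle_rf [Comp add_rf [Proj 0, Proj 1]], Proj 0]]"

primrec encode_rf :: "recf list \<Rightarrow> recf" where
  "encode_rf [] = Zero"
| "encode_rf (f # fs) = Comp encode_cons_rf [f, encode_rf fs]"

text \<open>Numerals are lists of empty lists, so a number used as input enters the Goedel number as
  a replicated code.\<close>

definition encode_replicate_rf :: "nat \<Rightarrow> recf" where
  "encode_replicate_rf c = PrimRec Zero (Comp encode_cons_rf [const_rf c, Proj 1])"

lemma reval_Proj: "i < length xs \<Longrightarrow> y = xs ! i \<Longrightarrow> reval (Proj i) xs y"
  by (simp add: reval.intros)

lemma reval_Comp1: "reval g xs y \<Longrightarrow> reval f [y] z \<Longrightarrow> reval (Comp f [g]) xs z"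
  by (auto intro: reval.intros(4)[of _ _ "[y]"])

lemma reval_Comp2:
  "reval g xs y \<Longrightarrow> reval h xs y' \<Longrightarrow> reval f [y, y'] z \<Longrightarrow> reval (Comp f [g, h]) xs z"
  by (auto intro: reval.intros(4)[of _ _ "[y, y']"])

lemma reval_const: "reval (const_rf n) xs n"
  by (induction n) (auto intro: reval.intros(1,2) reval_Comp1)

lemma reval_add: "reval add_rf [m, n] (m + n)"
  unfolding add_rf_def
proof (induction m)
  case 0
  show ?case by (auto intro!: reval.intros(5) reval_Proj)
next
  case (Suc m)
  have "reval (Comp Succ [Proj 1]) [m, m + n, n] (Suc (m + n))"
    by (rule reval_Comp1[OF reval_Proj reval.intros(2)]) auto
  from reval.intros(6)[OF Suc this] show ?case by simp
qed

lemma reval_triangle: "reval triangle_rf [n] (triangle n)"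
  unfolding triangle_rf_def
proof (induction n)
  case 0
  show ?case by (auto intro: reval.intros(1,5))
next
  case (Suc n)
  have "reval (Comp add_rf [Proj 1, Comp Succ [Proj 0]]) [n, triangle n] (triangle n + Suc n)"
    by (rule reval_Comp2[OF reval_Proj reval_Comp1[OF reval_Proj reval.intros(2)] reval_add]) auto
  from reval.intros(6)[OF Suc this] show ?case by simp
qed

lemma reval_encode_cons: "reval encode_cons_rf [x, list_encode xs] (list_encode (x # xs))"
proof -
  have "reval (Comp add_rf [Proj 0, Proj 1]) [x, l] (x + l)" for l
    by (rule reval_Comp2[OF reval_Proj reval_Proj reval_add]) auto
  from reval_Comp2[OF reval_Comp1[OF this reval_triangle] reval_Proj reval_add, of 0]
  show ?thesis
    unfolding encode_cons_rf_def
    by (auto intro!: reval_Comp1 simp: prod_encode_def intro: reval.intros(2))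
qed

lemma reval_encode:
  "list_all2 (\<lambda>f. reval f xs) fs ys \<Longrightarrow> reval (encode_rf fs) xs (list_encode ys)"
  by (induction rule: list_all2_induct)
    (simp_all add: reval.intros(1) reval_Comp2[OF _ _ reval_encode_cons] del: list_encode.simps(2))

lemma reval_encode_replicate:
  "reval (encode_replicate_rf c) [n] (list_encode (replicate n c))"
  unfolding encode_replicate_rf_def
proof (induction n)
  case 0
  show ?case by (auto intro: reval.intros(1,5))
next
  case (Suc n)
  show ?case
    unfolding replicate_Suc
    by (rule reval.intros(6)[OF Suc] reval_Comp2[OF reval_const reval_Proj reval_encode_cons])+ auto
qed


section \<open>The interpreter as a document theory\<close>

text \<open>
  A configuration is \<open>\<langle>stack, env, prog\<rangle>\<close>.  Programs and stack frames carry a tag as their head: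
  0 to 5 are the constructors of \<^typ>\<open>recf\<close>, 6 means that \<open>env\<close> is a result to be returned, and
  7 to 9 are the frames of \<open>Comp\<close>, \<open>PrimRec\<close> and \<open>Mu\<close>.  Argument lists are reversed, so that
  \<open>head\<close> is the first argument; accordingly \<open>Comp\<close> evaluates its inner functions from the last
  to the first, its second component collecting the results.
\<close>

definition tagged :: "nat \<Rightarrow> obj list \<Rightarrow> obj" where
  "tagged k xs = Ls (xs @ [Ur (Name k)])"

primrec quote_recf :: "recf \<Rightarrow> obj" where
  "quote_recf Zero = tagged 0 []"
| "quote_recf Succ = tagged 1 []"
| "quote_recf (Proj i) = tagged 2 [numeral_obj i]"
| "quote_recf (Comp f gs) = tagged 3 [quote_recf f, Ls [], Ls (map quote_recf gs)]"
| "quote_recf (PrimRec f g) = tagged 4 [quote_recf f, quote_recf g]"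
| "quote_recf (Mu f) = tagged 5 [quote_recf f]"

definition args :: "nat list \<Rightarrow> obj" where
  "args xs = Ls (rev (map numeral_obj xs))"

definition returned :: "obj list \<Rightarrow> nat \<Rightarrow> obj" where
  "returned K y = Ls [Ls K, numeral_obj y, tagged 6 []]"

definition term_list :: "'v dterm list \<Rightarrow> 'v dterm" where
  "term_list ts = foldl TCons TNil ts"

definition tagged_term :: "nat \<Rightarrow> 'v dterm list \<Rightarrow> 'v dterm" where
  "tagged_term k ts = term_list (ts @ [TConst (Name k)])"

primrec from_head :: "nat \<Rightarrow> 'v dterm \<Rightarrow> 'v dterm" where
  "from_head 0 t = THead t"
| "from_head (Suc n) t = from_head n (TTail t)"

definition has_tag :: "'v dterm \<Rightarrow> nat \<Rightarrow> 'v bform" where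
  "has_tag t k = FEq (THead t) (TConst (Name k))"

text \<open>The first matching rule fires, so a rule that follows a more specific one for the same
  tags is the default case. Result 0 on an empty stack matches no rule, which empties the queue; a
  nonzero result there reproduces the configuration.\<close>

definition transitions :: "(trans_var bform \<times> trans_var dterm) list" where
  "transitions =
    (let c = TVar TransParams;
         P = from_head 0 c; E = from_head 1 c; K = from_head 2 c;
         F = THead K; K' = TTail K; R = tagged_term 6 [];
         goto = (\<lambda>k e p. term_list [k, e, p])
     in
      [(has_tag P 0, goto K TNil R),
       (has_tag P 1, goto K (TCons (THead E) TNil) R),
       (FAnd (has_tag P 2) (FEq (from_head 1 P) TNil), goto K (THead E) R),
       (has_tag P 2, goto K (TTail E) (tagged_term 2 [TTail (from_head 1 P)])),
       (FAnd (has_tag P 3) (FEq (from_head 1 P) TNil), goto K (from_head 2 P) (from_head 3 P)),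
       (has_tag P 3,
         goto
          (TCons K
            (tagged_term 7 [from_head 3 P, from_head 2 P, TTail (from_head 1 P), E]))
          E (THead (from_head 1 P))),
       (FAnd (has_tag P 4) (FEq (THead E) TNil), goto K (TTail E) (from_head 2 P)),
       (has_tag P 4,
         goto (TCons K (tagged_term 8 [from_head 1 P, TTail E, TTail (THead E)]))
          (TCons (TTail E) (TTail (THead E))) P),
       (has_tag P 5,
         goto (TCons K (tagged_term 9 [from_head 1 P, E, TNil])) (TCons E TNil) (from_head 1 P)),
       (FAnd (has_tag P 6) (has_tag F 7),
         goto K' (from_head 1 F)
          (tagged_term 3 [from_head 4 F, TCons (from_head 3 F) E, from_head 2 F])),
       (FAnd (has_tag P 6) (has_tag F 8),
         goto K' (TCons (TCons (from_head 2 F) E) (from_head 1 F)) (from_head 3 F)),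
       (FAnd (has_tag P 6) (FAnd (has_tag F 9) (FEq E TNil)), goto K' (from_head 1 F) R),
       (FAnd (has_tag P 6) (has_tag F 9),
         goto
          (TCons K'
            (tagged_term 9 [from_head 3 F, from_head 2 F, TCons (from_head 1 F) TNil]))
          (TCons (from_head 2 F) (TCons (from_head 1 F) TNil)) (from_head 3 F)),
       (FAnd (has_tag P 6) (FAnd (FEq K TNil) (FNot (FEq E TNil))), c)])"

text \<open>
  Names: 0 is the only form, 1 a filter that accepts everything, 2 the only transaction.  The
  model has one document, so a call for each filtered document is a single call.  Its ID
  \<open>Ls [Ls []]\<close> is the number 1.
\<close>

definition interpreter :: doc_theory where
  "interpreter = DocTheory [] [(0, [])] [(1, FEq TNil TNil)] [2] []
     (map (\<lambda>(\<phi>, t). Rule 0 2 \<phi> [CallEach 1 0 TNil t 2]) transitions)"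

definition interpreter_model :: "obj list" where
  "interpreter_model = [Ls [Ls [], Ur (Name 0), Ls [], Ls [Ls []]]]"

definition call :: "obj \<Rightarrow> obj" where
  "call p = Ls [p, Ls [Ls []], Ur (Name 2)]"

definition call_env :: "obj \<Rightarrow> trans_var \<Rightarrow> obj" where
  "call_env p = trans_env (Ur (Name 2)) (Ls [Ls []]) p (Ls []) (Ls interpreter_model)"

definition next_queue :: "obj \<Rightarrow> obj list" where
  "next_queue p =
     cond (map (\<lambda>(\<phi>, t). (eval_bform (call_env p) \<phi>, [call (eval_dterm (call_env p) t)]))
       transitions) []"

lemma document_theory_interpreter: "document_theory interpreter"
  by (auto simp: document_theory_def interpreter_def form_names_def filter_names_def)

lemma elems_cond: "elems (cond cs q) = cond (map (\<lambda>(b, x). (b, elems x)) cs) (elems q)"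
  by (induction cs) auto

lemma is_natural_one: "is_natural (Ls [Ls []])"
  unfolding is_natural_def by (rule exI[of _ 1]) (simp add: numeral_obj_def)

text \<open>A transaction appends no version, so the model stays constant and the pending call alone
  determines the state of the chase.\<close>

lemma update_unfold_call:
  "update_unfold interpreter m interpreter_model [call p] = Recurse interpreter_model (next_queue p)"
proof -
  let ?i = "Ls [Ls []]" and ?m = "Ls interpreter_model"
  have form: "version_form (get_doc_by_id ?i ?m) = Ur (Name 0)"
    by (simp add: get_doc_by_id_def interpreter_model_def version_form_def version_id_def
        bsearch_def head_def tail_def)
  have docs: "get_docs_by_filter interpreter 1 (Ur (Name 0)) ?m x = Ls [?i]" for x
    by (simp add: get_docs_by_filter_def interpreter_def interpreter_model_def version_form_def
        version_id_def head_def tail_def)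
  have instrs: "eval_instrs interpreter e ?i ?m [CallEach 1 0 TNil t 2] = Ls [call (eval_dterm e t)]"
    for e t
    unfolding eval_instrs_def eval_instr.simps list.map docs
    by (simp add: rec_term_def cons_def conc_def call_def)
  have "elems (exec_trans interpreter (Ur (Name 2)) ?i p (Ls []) ?m) = next_queue p"
    unfolding exec_trans_def run_rules_def elems_cond next_queue_def call_env_def[symmetric]
    by (intro arg_cong2[where f = cond])
      (auto simp: interpreter_def[THEN arg_cong[of _ _ trans_rules]] form instrs conc_def
        simp del: One_nat_def)
  moreover have "2 \<in> set (trans_names interpreter)"
    by (simp add: interpreter_def)
  ultimately show ?thesis
    by (simp add: update_unfold_def call_def is_natural_one)
qed

lemma chase_step_call:
  "chase_step interpreter (interpreter_model, [call p]) s \<longleftrightarrow>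
   s = (interpreter_model, next_queue p)"
  by (cases s) (auto simp: chase_step_def update_unfold_call)


section \<open>Simulation\<close>

definition moves :: "obj \<Rightarrow> obj \<Rightarrow> bool" where
  "moves p p' \<longleftrightarrow> next_queue p = [call p']"

lemma eval_term_list [simp]: "eval_dterm e (term_list ts) = Ls (map (eval_dterm e) ts)"
  unfolding term_list_def by (induction ts rule: rev_induct) (simp_all add: cons_def)

lemma eval_tagged_term [simp]: "eval_dterm e (tagged_term k ts) = tagged k (map (eval_dterm e) ts)"
  by (simp add: tagged_term_def tagged_def)

lemma eval_has_tag [simp]:
  "eval_bform e (has_tag t k) \<longleftrightarrow> head (eval_dterm e t) = Ur (Name k)"
  by (simp add: has_tag_def)

lemma numeral_obj_0: "numeral_obj 0 = Ls []"
  and numeral_obj_eq_Nil [simp]: "numeral_obj n = Ls [] \<longleftrightarrow> n = 0"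
  and cons_numeral_obj [simp]: "cons (numeral_obj n) (Ls []) = numeral_obj (Suc n)"
  by (simp_all add: numeral_obj_def cons_def replicate_append_same)

lemma tail_numeral_obj [simp]: "tail (numeral_obj (Suc n)) = numeral_obj n"
  by (simp add: numeral_obj_def tail_def flip: replicate_append_same)

lemma head_args [simp]: "head (args (x # xs)) = numeral_obj x"
  and tail_args [simp]: "tail (args (x # xs)) = args xs"
  and cons_args [simp]: "cons (args xs) (numeral_obj x) = args (x # xs)"
  by (simp_all add: args_def head_def tail_def cons_def)

lemma head_Ls: "head (Ls xs) = (if xs = [] then Ls [] else last xs)"
  and tail_Ls: "tail (Ls xs) = Ls (butlast xs)"
  and cons_Ls: "cons (Ls xs) x = Ls (xs @ [x])"
  by (simp_all add: head_def tail_def cons_def)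

text \<open>Collapses nested selectors into one lookup, so that simplification alone can decide
  which rule fires. Positions past the end yield the empty list because \<open>head\<close> and
  \<open>tail\<close> are total.\<close>

lemma eval_from_head:
  "eval_dterm e (from_head n t) =
     (let xs = rev (elems (eval_dterm e t)) in if n < length xs then xs ! n else Ls [])"
proof (induction n arbitrary: t)
  case 0
  show ?case by (simp add: head_def hd_rev flip: hd_conv_nth)
next
  case (Suc n)
  show ?case by (auto simp: Suc tail_def Let_def rev_nth nth_butlast less_diff_conv)
qed

lemmas moves_simps =
  moves_def next_queue_def transitions_def Let_def call_env_def eval_from_head tagged_def
  head_Ls tail_Ls cons_Ls

section \<open>Single machine steps, by constructor and stack frame\<close>

lemma moves_Zero: "moves (Ls [K, E, tagged 0 []]) (Ls [K, Ls [], tagged 6 []])"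
  and moves_Succ: "moves (Ls [K, E, tagged 1 []]) (Ls [K, cons (head E) (Ls []), tagged 6 []])"
  by (simp_all add: moves_simps)

lemma moves_Proj_0: "moves (Ls [K, E, tagged 2 [Ls []]]) (Ls [K, head E, tagged 6 []])"
  and moves_Proj_Suc:
    "i \<noteq> Ls [] \<Longrightarrow> moves (Ls [K, E, tagged 2 [i]]) (Ls [K, tail E, tagged 2 [tail i]])"
  by (simp_all add: moves_simps)

lemma moves_Comp_Nil: "moves (Ls [Ls K, E, tagged 3 [f, ys, Ls []]]) (Ls [Ls K, ys, f])"
  and moves_Comp_snoc:
    "moves (Ls [Ls K, E, tagged 3 [f, ys, Ls (gs @ [g])]])
       (Ls [Ls (K @ [tagged 7 [f, ys, Ls gs, E]]), E, g])"
  and moves_Comp_return: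
    "moves (Ls [Ls (K @ [tagged 7 [f, ys, Ls gs, E]]), y, tagged 6 []])
       (Ls [Ls K, E, tagged 3 [f, cons ys y, Ls gs]])"
  by (simp_all add: moves_simps)

lemma moves_PrimRec_0:
    "head E = Ls [] \<Longrightarrow> moves (Ls [Ls K, E, tagged 4 [f, g]]) (Ls [Ls K, tail E, f])"
  and moves_PrimRec_Suc:
    "head E \<noteq> Ls [] \<Longrightarrow>
     moves (Ls [Ls K, E, tagged 4 [f, g]])
       (Ls [Ls (K @ [tagged 8 [g, tail E, tail (head E)]]),
            cons (tail E) (tail (head E)), tagged 4 [f, g]])"
  and moves_PrimRec_return:
    "moves (Ls [Ls (K @ [tagged 8 [g, E, n]]), y, tagged 6 []])
       (Ls [Ls K, cons (cons E y) n, g])"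
  by (simp_all add: moves_simps)

lemma moves_Mu:
    "moves (Ls [Ls K, E, tagged 5 [f]])
       (Ls [Ls (K @ [tagged 9 [f, E, Ls []]]), cons E (Ls []), f])"
  and moves_Mu_return_0:
    "moves (Ls [Ls (K @ [tagged 9 [f, E, n]]), Ls [], tagged 6 []]) (Ls [Ls K, n, tagged 6 []])"
  and moves_Mu_return_Suc:
    "y \<noteq> Ls [] \<Longrightarrow>
     moves (Ls [Ls (K @ [tagged 9 [f, E, n]]), y, tagged 6 []])
       (Ls [Ls (K @ [tagged 9 [f, E, cons n (Ls [])]]), cons E (cons n (Ls [])), f])"
  by (simp_all add: moves_simps)

lemma moves_loop:
    "y \<noteq> Ls [] \<Longrightarrow>
     moves (Ls [Ls [], y, tagged 6 []]) (Ls [Ls [], y, tagged 6 []])"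
  and next_queue_halt: "next_queue (Ls [Ls [], Ls [], tagged 6 []]) = []"
  by (simp_all add: moves_simps)

section \<open>Complete evaluations as sequences of machine steps\<close>

abbreviation runs :: "obj \<Rightarrow> obj \<Rightarrow> bool" where
  "runs \<equiv> moves\<^sup>*\<^sup>*"

text \<open>The stack \<open>K\<close> is arbitrary because a subcomputation runs on top of the
  frames of its callers and must leave them intact.\<close>

abbreviation evaluates :: "recf \<Rightarrow> nat list \<Rightarrow> nat \<Rightarrow> bool" where
  "evaluates f xs y \<equiv>
     (\<forall>K. runs (Ls [Ls K, args xs, quote_recf f]) (Ls [Ls K, numeral_obj y, tagged 6 []]))"

lemma runs_Proj:
  "i < length xs \<Longrightarrow>
   runs (Ls [K, args xs, quote_recf (Proj i)]) (Ls [K, numeral_obj (xs ! i), tagged 6 []])"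
proof (induction i arbitrary: xs)
  case 0
  then show ?case using moves_Proj_0[of K "args xs"] by (cases xs) (auto simp: numeral_obj_0)
next
  case (Suc i)
  then obtain x xs' where xs: "xs = x # xs'" by (cases xs) auto
  from Suc.IH[of xs'] Suc.prems moves_Proj_Suc[of "numeral_obj (Suc i)" K "args xs"]
  show ?case by (simp add: xs converse_rtranclp_into_rtranclp)
qed

text \<open>The induction goes from the right because the last inner function is evaluated first.
  \<open>zs\<close> generalises the collected results; for empty \<open>zs\<close> the final
  environment is \<open>args ys\<close>.\<close>

lemma runs_Comp:
  assumes "list_all2 (\<lambda>g. evaluates g xs) gs ys"
  shows "runs (Ls [Ls K, args xs, tagged 3 [f, Ls zs, Ls (map quote_recf gs)]])
     (Ls [Ls K, Ls (zs @ rev (map numeral_obj ys)), f])"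
  using assms
proof (induction gs arbitrary: ys zs rule: rev_induct)
  case Nil
  then show ?case by (simp add: r_into_rtranclp moves_Comp_Nil)
next
  case (snoc g gs)
  then obtain ys' y where ys: "ys = ys' @ [y]" and gs: "list_all2 (\<lambda>g. evaluates g xs) gs ys'"
    and g: "evaluates g xs y"
    by (auto simp: list_all2_append1 list_all2_Cons1)
  let ?frame = "tagged 7 [f, Ls zs, Ls (map quote_recf gs), args xs]"
  have "runs (Ls [Ls K, args xs, tagged 3 [f, Ls zs, Ls (map quote_recf (gs @ [g]))]])
      (Ls [Ls (K @ [?frame]), args xs, quote_recf g])"
    by (simp add: r_into_rtranclp moves_Comp_snoc)
  also have "runs \<dots> (Ls [Ls (K @ [?frame]), numeral_obj y, tagged 6 []])"
    using g by blast
  also have "runs \<dots> (Ls [Ls K, args xs,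
      tagged 3 [f, Ls (zs @ [numeral_obj y]), Ls (map quote_recf gs)]])"
    using moves_Comp_return[of K f "Ls zs"] by (simp add: r_into_rtranclp cons_Ls)
  also have "runs \<dots> (Ls [Ls K, Ls (zs @ rev (map numeral_obj ys)), f])"
    using snoc.IH[OF gs, of "zs @ [numeral_obj y]"] by (simp add: ys)
  finally show ?case .
qed

text \<open>The frame with tag 9 stores the current candidate \<open>i\<close>. State
  \<open>?s i\<close> begins testing it and \<open>?r i y\<close> is the return of the test value
  \<open>y\<close>.\<close>

lemma evaluates_Mu:
  assumes "evaluates f (n # xs) 0" and "\<forall>i<n. \<exists>y. evaluates f (i # xs) (Suc y)"
  shows "evaluates (Mu f) xs n"
proof
  fix K
  let ?s = "\<lambda>i. Ls [Ls (K @ [tagged 9 [quote_recf f, args xs, numeral_obj i]]),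
    args (i # xs), quote_recf f]"
  let ?r = "\<lambda>i y. Ls [Ls (K @ [tagged 9 [quote_recf f, args xs, numeral_obj i]]),
    numeral_obj y, tagged 6 []]"
  \<comment> \<open>Every candidate below \<open>n\<close> yields a positive value, which advances
    the counter by one.\<close>
  have "runs (?s 0) (?s i)" if "i \<le> n" for i
    using that
  proof (induction i)
    case (Suc i)
    from assms(2) Suc_le_lessD[OF Suc.prems] obtain y where "evaluates f (i # xs) (Suc y)"
      by blast
    then have "runs (?s i) (?r i (Suc y))" by blast
    moreover have "moves (?r i (Suc y)) (?s (Suc i))"
      using moves_Mu_return_Suc[of "numeral_obj (Suc y)" K "quote_recf f" "args xs" "numeral_obj i"]
      by simp
    ultimately show ?case using Suc by (meson Suc_leD rtranclp.rtrancl_into_rtrancl rtranclp_trans)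
  qed simp
  note loop = this[of n]
  have "runs (Ls [Ls K, args xs, quote_recf (Mu f)]) (?s 0)"
    using moves_Mu[of K "args xs" "quote_recf f"]
    by (simp add: r_into_rtranclp flip: numeral_obj_0)
  also have "runs (?s 0) (?s n)"
    using loop by simp
  also have "runs \<dots> (?r n 0)"
    using assms(1) by blast
  also have "runs \<dots> (Ls [Ls K, numeral_obj n, tagged 6 []])"
    by (simp add: r_into_rtranclp moves_Mu_return_0 numeral_obj_0)
  finally show "runs (Ls [Ls K, args xs, quote_recf (Mu f)])
    (Ls [Ls K, numeral_obj n, tagged 6 []])" .
qed

lemma evaluates: "reval f xs y \<Longrightarrow> evaluates f xs y"
proof (induction rule: reval.induct)
  case (1 xs)
  then show ?case by (simp add: numeral_obj_0 r_into_rtranclp moves_Zero)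
next
  case (2 x)
  then show ?case
    using moves_Succ[of _ "args [x]"] by (simp add: r_into_rtranclp)
next
  case (3 i xs)
  then show ?case using runs_Proj by blast
next
  case (4 xs gs ys f z)
  from 4(1) have "list_all2 (\<lambda>g. evaluates g xs) gs ys"
    by (rule list_all2_mono) blast
  from runs_Comp[OF this, of _ "quote_recf f" "[]"] 4(2) show ?case
    by (auto simp: args_def intro: rtranclp_trans)
next
  case (5 f xs z g)
  show ?case
    using 5 moves_PrimRec_0[of "args (0 # xs)" _ "quote_recf f" "quote_recf g"]
    by (auto simp: numeral_obj_0 intro: converse_rtranclp_into_rtranclp)
next
  case (6 f g n xs y z)
  show ?case
  proof
    fix K
    let ?frame = "tagged 8 [quote_recf g, args xs, numeral_obj n]"
    have "runs (Ls [Ls K, args (Suc n # xs), quote_recf (PrimRec f g)])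
        (Ls [Ls (K @ [?frame]), args (n # xs), quote_recf (PrimRec f g)])"
      using moves_PrimRec_Suc[of "args (Suc n # xs)" K "quote_recf f" "quote_recf g"]
      by (simp add: r_into_rtranclp)
    also have "runs \<dots> (Ls [Ls (K @ [?frame]), numeral_obj y, tagged 6 []])"
      using 6 by blast
    also have "runs \<dots> (Ls [Ls K, args (n # y # xs), quote_recf g])"
      using moves_PrimRec_return[of K "quote_recf g" "args xs" "numeral_obj n" "numeral_obj y"]
      by (simp add: r_into_rtranclp)
    also have "runs \<dots> (Ls [Ls K, numeral_obj z, tagged 6 []])"
      using 6 by blast
    finally show "runs (Ls [Ls K, args (Suc n # xs), quote_recf (PrimRec f g)])
      (Ls [Ls K, numeral_obj z, tagged 6 []])" .
  qed
next
  case (7 f n xs)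
  then show ?case by (intro evaluates_Mu) blast+
qed


section \<open>Termination of the chase\<close>

text \<open>The bound \<open>k \<ge> 1\<close> on sequences is why the transitive closure appears
  and not the reflexive one.\<close>

lemma terminating_iff_reaches:
  "(\<exists>ss. terminating_chase_sequence T s ss) \<longleftrightarrow> (\<exists>m. (chase_step T)\<^sup>+\<^sup>+ s (m, []))"
proof
  assume "\<exists>ss. terminating_chase_sequence T s ss"
  then obtain ss k where k: "k \<ge> 1" and ss: "ss ! 0 = s" "snd (ss ! k) = []"
    "\<forall>i<k. chase_step T (ss ! i) (ss ! Suc i)"
    by (auto simp: terminating_chase_sequence_def)
  have "(chase_step T ^^ k) s (ss ! k)"
    unfolding relpowp_fun_conv by (rule exI[of _ "(!) ss"]) (use ss in auto)
  then have "(chase_step T)\<^sup>+\<^sup>+ s (fst (ss ! k), [])"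
    using k ss(2) by (metis tranclp_power less_le_trans zero_less_one prod.collapse)
  then show "\<exists>m. (chase_step T)\<^sup>+\<^sup>+ s (m, [])" ..
next
  assume "\<exists>m. (chase_step T)\<^sup>+\<^sup>+ s (m, [])"
  then obtain m k where "k > 0" "(chase_step T ^^ k) s (m, [])"
    by (auto simp: tranclp_power)
  then obtain w where "w 0 = s" "w k = (m, [])" "\<forall>i<k. chase_step T (w i) (w (Suc i))"
    unfolding relpowp_fun_conv by auto
  with \<open>k > 0\<close> have "terminating_chase_sequence T s (map w [0..<Suc k])"
    unfolding terminating_chase_sequence_def
    by (intro exI[of _ k]) (auto simp del: upt_Suc)
  then show "\<exists>ss. terminating_chase_sequence T s ss" ..
qed

lemma chase_step_unique: "chase_step T s t \<Longrightarrow> chase_step T s u \<Longrightarrow> t = u"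
  by (auto simp: chase_step_def prod_eq_iff)

lemma chase_step_nonempty: "chase_step T s t \<Longrightarrow> snd s \<noteq> []"
  by (simp add: chase_step_def)

text \<open>The chase is deterministic, so every run from \<open>s\<close> follows the path to
  \<open>t\<close> and then stays there; the queue of \<open>t\<close> is nonempty since
  \<open>t\<close> has a successor.\<close>

lemma cycle_not_terminating:
  assumes "(chase_step T)\<^sup>*\<^sup>* s t" and "chase_step T t t"
  shows "\<not> (chase_step T)\<^sup>*\<^sup>* s (m, [])"
  using assms(1)
proof (induction rule: converse_rtranclp_induct)
  case base
  have "u = t" if "(chase_step T)\<^sup>*\<^sup>* t u" for u
    using that by induction (use assms(2) chase_step_unique in blast)+
  with chase_step_nonempty[OF assms(2)] show ?case by force
next
  case (step s u)
  show ?case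
  proof
    assume "(chase_step T)\<^sup>*\<^sup>* s (m, [])"
    then show False
      using step.IH chase_step_unique[OF step.hyps(1)] chase_step_nonempty[OF step.hyps(1)]
      by (cases rule: converse_rtranclpE) auto
  qed
qed

lemma runs_chase:
  "runs p p' \<Longrightarrow>
   (chase_step interpreter)\<^sup>*\<^sup>* (interpreter_model, [call p]) (interpreter_model, [call p'])"
  by (induction rule: rtranclp_induct)
    (auto simp: moves_def chase_step_call intro: rtranclp.rtrancl_into_rtrancl)

definition start :: "recf \<Rightarrow> nat \<Rightarrow> obj" where
  "start f n = Ls [Ls [], args [n], quote_recf f]"

definition interpreter_instance :: "recf \<Rightarrow> nat \<Rightarrow> doc_theory \<times> obj list \<times> obj list" where
  "interpreter_instance f n = (interpreter, interpreter_model, [call (start f n)])"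

lemma result_zero_terminates:
  assumes "reval f [n] 0"
  shows "\<exists>ss. terminating_chase_sequence interpreter (interpreter_model, [call (start f n)]) ss"
proof -
  let ?p = "Ls [Ls [], Ls [], tagged 6 []]"
  have "runs (start f n) ?p"
    using evaluates[OF assms] by (simp add: start_def numeral_obj_0)
  moreover have "chase_step interpreter (interpreter_model, [call ?p]) (interpreter_model, [])"
    by (simp add: chase_step_call next_queue_halt)
  ultimately show ?thesis
    unfolding terminating_iff_reaches by (meson runs_chase rtranclp_into_tranclp1)
qed

lemma result_nonzero_not_terminates:
  assumes "reval f [n] (Suc y)"
  shows "\<not> (\<exists>ss. terminating_chase_sequence interpreter (interpreter_model, [call (start f n)]) ss)"
proof -
  let ?p = "Ls [Ls [], numeral_obj (Suc y), tagged 6 []]"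
  have "runs (start f n) ?p"
    using evaluates[OF assms] by (simp add: start_def)
  moreover have "chase_step interpreter (interpreter_model, [call ?p]) (interpreter_model, [call ?p])"
    using moves_loop by (simp add: chase_step_call moves_def)
  ultimately show ?thesis
    unfolding terminating_iff_reaches
    by (meson runs_chase cycle_not_terminating tranclp_into_rtranclp)
qed


section \<open>Diagonalisation\<close>

text \<open>The argument is used twice: verbatim by \<open>Proj 0\<close>, as the code of the quoted
  program, and through \<open>num_rf\<close> as the code of the numeral given to that program. The
  factor 1 in \<open>obj_rf\<close> is the tag of \<open>Ls\<close> in
  \<open>code_obj\<close>.\<close>

definition diagonal_rf :: recf where
  "diagonal_rf =
     (let obj_rf = (\<lambda>fs. encode_rf [const_rf 1, encode_rf fs]);
          num_rf = encode_rf [const_rf 1, encode_replicate_rf (code_obj (Ls []))];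
          start_rf = obj_rf [const_rf (code_obj (Ls [])), obj_rf [num_rf], Proj 0];
          call_rf = obj_rf [start_rf, const_rf (code_obj (Ls [Ls []])),
            const_rf (code_obj (Ur (Name 2)))]
      in encode_rf [const_rf (code_theory interpreter), const_rf (code_objs interpreter_model),
           encode_rf [call_rf]])"

lemma reval_diagonal:
  assumes "n = code_obj (quote_recf f)"
  shows "reval diagonal_rf [n] (code_instance (interpreter_instance f n))"
proof -
  have obj: "reval (encode_rf [const_rf 1, encode_rf fs]) [n] (code_obj (Ls xs))"
    if "list_all2 (\<lambda>f x. reval f [n] (code_obj x)) fs xs" for fs xs
    unfolding code_obj.simps
    by (intro reval_encode list.rel_intros reval_const) (use that in \<open>simp add: list.rel_map\<close>)
  have num: "reval (encode_rf [const_rf 1, encode_replicate_rf (code_obj (Ls []))]) [n]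
    (code_obj (numeral_obj n))"
    unfolding numeral_obj_def code_obj.simps(2) map_replicate
    by (intro reval_encode list.rel_intros reval_const reval_encode_replicate)
  \<comment> \<open>Here \<open>n\<close> has to be the code of the program itself.\<close>
  have proj: "reval (Proj 0) [n] (code_obj (quote_recf f))"
    using assms by (intro reval_Proj) auto
  show ?thesis
    unfolding diagonal_rf_def Let_def code_instance_def interpreter_instance_def fst_conv snd_conv
      code_objs_def[of "[_]"] list.map call_def start_def args_def rev.simps append.simps
    by (intro reval_encode list.rel_intros reval_const obj num proj)
qed

theorem theorem1:
  "\<not> decidable_problem code_instance
       {(T, model, queue). document_theory T}
       (\<lambda>(T, model, queue). \<exists>ss. terminating_chase_sequence T (model, queue) ss)"
proof
  assume "decidable_problem code_instance
       {(T, model, queue). document_theory T}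
       (\<lambda>(T, model, queue). \<exists>ss. terminating_chase_sequence T (model, queue) ss)"
  then obtain f where f: "\<And>T model queue. document_theory T \<Longrightarrow>
      reval f [code_instance (T, model, queue)]
        (if \<exists>ss. terminating_chase_sequence T (model, queue) ss then 1 else 0)"
    unfolding decidable_problem_def by fastforce
  define g where "g = Comp f [diagonal_rf]"
  define n where "n = code_obj (quote_recf g)"
  let ?P = "\<exists>ss. terminating_chase_sequence interpreter (interpreter_model, [call (start g n)]) ss"
  have "reval g [n] (if ?P then 1 else 0)"
    unfolding g_def
    by (rule reval_Comp1[OF reval_diagonal[OF n_def]])
      (unfold interpreter_instance_def g_def[symmetric], rule f[OF document_theory_interpreter])
  \<comment> \<open>Answer 1 claims termination but drives the interpreter into its loop (with
    \<open>y = 0\<close>, the result is \<open>Suc 0\<close>); answer 0 denies it but makes the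
    interpreter halt.\<close>
  then show False
    using result_zero_terminates[of g n] result_nonzero_not_terminates[of g n 0]
    by (cases ?P) auto
qed

end
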